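(* Let $P=\langle X\mid R\rangle$ and $Q=\langle X\mid S\rangle$ be two balanced presentations of the trivial group on the same generators $X=\{x_1,\dots,x_n\}$, with $R=(r_1,\dots,r_n)$ and $S=(s_1,\dots,s_n)$. Then the composition $P\circ Q=\langle X\mid R(S)\rangle$ also presents the trivial group.
   Context: A presentation is balanced if the number of relators equals the number of generators; the relators form an ordered tuple. For $P=\langle X\mid r_1,\dots,r_n\rangle$ and $Q=\langle X\mid s_1,\dots,s_n\rangle$, where $r_i=r_i(X)$, $s_i=s_i(X)$ are words in $x_1,\dots,x_n$, the composition is $P\circ Q=\langle X\mid R(S)\rangle=\langle x_1,\dots,x_n\mid r_1(S),\dots,r_n(S)\rangle$, where $r_i(S)$ is the word obtained from $r_i(X)$ by replacing $x_j$ by $s_j$ for all $j$. *)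

theory Defs
  imports "HOL-Algebra.Algebra"
begin

section \<open>Words and free groups\<close>

text \<open>The letter \<open>(j, True)\<close> stands for the generator \<open>x\<^sub>j\<close> and \<open>(j, False)\<close> for its formal
  inverse. Generators are indexed from 0, so that \<open>S ! j\<close> is the entry of a tuple \<open>S\<close>
  that belongs to \<open>x\<^sub>j\<close>. Words need not be reduced.\<close>

type_synonym word = "(nat \<times> bool) list"

definition words :: "nat \<Rightarrow> word set" where
  "words n = lists ({..<n} \<times> UNIV)"

definition inv_word :: "word \<Rightarrow> word" where
  "inv_word w = rev (map (\<lambda>(j, e). (j, \<not> e)) w)"

inductive_set free_eq :: "nat \<Rightarrow> (word \<times> word) set" for n where
  refl: "w \<in> words n \<Longrightarrow> (w, w) \<in> free_eq n"
| sym: "(u, v) \<in> free_eq n \<Longrightarrow> (v, u) \<in> free_eq n"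
| trans: "(u, v) \<in> free_eq n \<Longrightarrow> (v, w) \<in> free_eq n \<Longrightarrow> (u, w) \<in> free_eq n"
| cancel: "u \<in> words n \<Longrightarrow> v \<in> words n \<Longrightarrow> j < n \<Longrightarrow>
    (u @ [(j, e), (j, \<not> e)] @ v, u @ v) \<in> free_eq n"

definition word_class :: "nat \<Rightarrow> word \<Rightarrow> word set" where
  "word_class n w = free_eq n `` {w}"

definition free_group :: "nat \<Rightarrow> word set monoid" where
  "free_group n =
     \<lparr>carrier = words n // free_eq n,
      monoid.mult = (\<lambda>A B. \<Union>u\<in>A. \<Union>v\<in>B. word_class n (u @ v)),
      one = word_class n []\<rparr>"

section \<open>Presentations\<close>

definition normal_closure :: "('a, 'b) monoid_scheme \<Rightarrow> 'a set \<Rightarrow> 'a set" where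
  "normal_closure G A = \<Inter> {N. N \<lhd> G \<and> A \<subseteq> N}"

datatype presentation = Presentation (num_gens: nat) (relators: "word list")

definition is_presentation :: "presentation \<Rightarrow> bool" where
  "is_presentation P \<longleftrightarrow> set (relators P) \<subseteq> words (num_gens P)"

definition balanced :: "presentation \<Rightarrow> bool" where
  "balanced P \<longleftrightarrow> length (relators P) = num_gens P"

definition presented_group :: "presentation \<Rightarrow> word set set monoid" where
  "presented_group P =
     free_group (num_gens P) Mod
       normal_closure (free_group (num_gens P)) (word_class (num_gens P) ` set (relators P))"

definition subst_word :: "word list \<Rightarrow> word \<Rightarrow> word" where
  "subst_word S w = concat (map (\<lambda>(j, e). if e then S ! j else inv_word (S ! j)) w)"

definition compose_presentation :: "presentation \<Rightarrow> presentation \<Rightarrow> presentation" where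
  "compose_presentation P Q =
     Presentation (num_gens P) (map (subst_word (relators Q)) (relators P))"

section \<open>Well-definedness\<close>

lemma words_simps [simp]:
  "[] \<in> words n" "u @ v \<in> words n \<longleftrightarrow> u \<in> words n \<and> v \<in> words n"
  "(x # u) \<in> words n \<longleftrightarrow> fst x < n \<and> u \<in> words n"
  by (cases x; auto simp: words_def)+

lemma inv_word_in_words [simp]: "inv_word w \<in> words n \<longleftrightarrow> w \<in> words n"
  by (induction w) (auto simp: inv_word_def)

lemma free_eq_in_words: "(u, v) \<in> free_eq n \<Longrightarrow> u \<in> words n \<and> v \<in> words n"
  by (induction rule: free_eq.induct) auto

lemma equiv_free_eq: "equiv (words n) (free_eq n)"
proof (rule equivI)
  show "free_eq n \<subseteq> words n \<times> words n"
    by (auto dest: free_eq_in_words)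
  show "refl_on (words n) (free_eq n)"
    by (rule refl_onI) (rule free_eq.refl)
  show "sym (free_eq n)"
    by (rule symI) (rule free_eq.sym)
  show "trans (free_eq n)"
    by (rule transI) (rule free_eq.trans)
qed

lemma free_eq_context:
  assumes "(u, v) \<in> free_eq n" "a \<in> words n" "b \<in> words n"
  shows "(a @ u @ b, a @ v @ b) \<in> free_eq n"
  using assms(1)
proof (induction rule: free_eq.induct)
  case (cancel u v j e)
  then show ?case
    using free_eq.cancel[of "a @ u" n "v @ b" j e] assms by simp
next
  case (refl w)
  then show ?case
    using assms(2,3) by (simp add: free_eq.refl)
next
  case (sym u v)
  then show ?case
    by (simp add: free_eq.sym)
next
  case (trans u v w)
  then show ?case
    using free_eq.trans by blast
qed

lemma free_eq_append:
  assumes "(u, u') \<in> free_eq n" "(v, v') \<in> free_eq n"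
  shows "(u @ v, u' @ v') \<in> free_eq n"
proof (rule free_eq.trans)
  show "(u @ v, u' @ v) \<in> free_eq n"
    using free_eq_context[OF assms(1), of "[]" v] free_eq_in_words[OF assms(2)] by simp
  show "(u' @ v, u' @ v') \<in> free_eq n"
    using free_eq_context[OF assms(2), of u' "[]"] free_eq_in_words[OF assms(1)] by simp
qed

lemma word_class_eq_iff:
  "u \<in> words n \<Longrightarrow> v \<in> words n \<Longrightarrow> word_class n u = word_class n v \<longleftrightarrow> (u, v) \<in> free_eq n"
  unfolding word_class_def by (rule eq_equiv_class_iff[OF equiv_free_eq])

lemma carrier_free_group: "carrier (free_group n) = word_class n ` words n"
  by (auto simp: free_group_def quotient_def word_class_def)

lemma one_free_group: "\<one>\<^bsub>free_group n\<^esub> = word_class n []"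
  by (simp add: free_group_def)

lemma mult_free_group:
  assumes "u \<in> words n" "v \<in> words n"
  shows "word_class n u \<otimes>\<^bsub>free_group n\<^esub> word_class n v = word_class n (u @ v)"
proof -
  have *: "word_class n (a @ b) = word_class n (u @ v)"
    if "a \<in> word_class n u" "b \<in> word_class n v" for a b
  proof -
    from that have "(u, a) \<in> free_eq n" "(v, b) \<in> free_eq n"
      by (auto simp: word_class_def)
    then have "(a @ b, u @ v) \<in> free_eq n"
      by (intro free_eq.sym[OF free_eq_append])
    then show ?thesis
      using free_eq_in_words word_class_eq_iff by blast
  qed
  have "word_class n u \<otimes>\<^bsub>free_group n\<^esub> word_class n v =
      (\<Union>a\<in>word_class n u. \<Union>b\<in>word_class n v. word_class n (a @ b))"
    by (simp add: free_group_def)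
  also have "\<dots> = (\<Union>a\<in>word_class n u. \<Union>b\<in>word_class n v. word_class n (u @ v))"
    by (rule SUP_cong[OF HOL.refl], rule SUP_cong[OF HOL.refl], rule *)
  finally have eq: "word_class n u \<otimes>\<^bsub>free_group n\<^esub> word_class n v =
      (\<Union>a\<in>word_class n u. \<Union>b\<in>word_class n v. word_class n (u @ v))" .
  have "u \<in> word_class n u" "v \<in> word_class n v"
    using assms by (auto simp: word_class_def intro: free_eq.refl)
  then show ?thesis
    unfolding eq by blast
qed

lemma free_eq_inv_word: "w \<in> words n \<Longrightarrow> (inv_word w @ w, []) \<in> free_eq n"
proof (induction w)
  case Nil
  then show ?case by (simp add: inv_word_def free_eq.refl)
next
  case (Cons x w)
  obtain j e where x: "x = (j, e)" by force
  have "(inv_word w @ [(j, \<not> e), (j, \<not> \<not> e)] @ w, inv_word w @ w) \<in> free_eq n"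
    using Cons.prems x by (intro free_eq.cancel) auto
  moreover have "(inv_word w @ w, []) \<in> free_eq n"
    using Cons by simp
  ultimately have "(inv_word w @ [(j, \<not> e), (j, \<not> \<not> e)] @ w, []) \<in> free_eq n"
    by (rule free_eq.trans)
  then show ?case
    by (simp add: x inv_word_def)
qed

lemma group_free_group: "group (free_group n)"
proof (rule groupI)
  fix A assume "A \<in> carrier (free_group n)"
  then obtain w where w: "A = word_class n w" "w \<in> words n"
    by (auto simp: carrier_free_group)
  have "word_class n (inv_word w) \<otimes>\<^bsub>free_group n\<^esub> A = \<one>\<^bsub>free_group n\<^esub>"
    using w free_eq_inv_word by (simp add: mult_free_group one_free_group word_class_eq_iff)
  then show "\<exists>B\<in>carrier (free_group n). B \<otimes>\<^bsub>free_group n\<^esub> A = \<one>\<^bsub>free_group n\<^esub>"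
    using w by (auto simp: carrier_free_group)
qed (auto simp: carrier_free_group one_free_group mult_free_group)

lemma normal_normal_closure:
  assumes "group G" "A \<subseteq> carrier G"
  shows "normal_closure G A \<lhd> G"
proof -
  interpret group G by fact
  let ?\<N> = "{N. N \<lhd> G \<and> A \<subseteq> N}"
  have ne: "?\<N> \<noteq> {}"
    using normal_self assms(2) by auto
  have "subgroup (\<Inter> ?\<N>) G"
    using ne by (intro subgroups_Inter) (auto simp: normal_imp_subgroup)
  then show ?thesis
    unfolding normal_closure_def by (subst normal_inv_iff) (auto simp: normal_inv_iff)
qed

lemma group_presented_group:
  assumes "is_presentation P"
  shows "group (presented_group P)"
  unfolding presented_group_def
  using assms
  by (intro normal.factorgroup_is_group normal_normal_closure group_free_group)
    (auto simp: is_presentation_def carrier_free_group)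

lemma subst_word_in_words:
  assumes "w \<in> words n" "length S = n" "set S \<subseteq> words n"
  shows "subst_word S w \<in> words n"
  using assms(1)
proof (induction w)
  case (Cons x w)
  then show ?case
    using assms(2,3) by (cases x) (auto simp: subst_word_def subset_iff)
qed (simp add: subst_word_def)

lemma is_presentation_compose:
  assumes "is_presentation P" "is_presentation Q" "balanced Q" "num_gens P = num_gens Q"
  shows "is_presentation (compose_presentation P Q)"
  using assms
  by (auto simp: is_presentation_def balanced_def compose_presentation_def
      intro!: subst_word_in_words)

lemma balanced_compose: "balanced P \<Longrightarrow> balanced (compose_presentation P Q)"
  by (simp add: balanced_def compose_presentation_def)

end

(* Substituting S for the generators is an endomorphism of the free group F. It maps the normal
   closure of R into the normal closure N of R(S). As the former is all of F, N contains the image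
   of each generator, that is, the tuple S; hence N contains the normal closure of S, which is F. *)

theory Submission
  imports Defs
begin

text \<open>The preimage of \<open>N\<close> is the kernel of \<open>h\<close> followed by the
  projection onto \<open>H Mod N\<close>, and kernels are normal.\<close>

lemma (in group_hom) normal_preimage:
  assumes "N \<lhd> H"
  shows "{x \<in> carrier G. h x \<in> N} \<lhd> G"
proof -
  interpret N: normal N H by fact
  have hom: "(\<lambda>x. N #>\<^bsub>H\<^esub> h x) \<in> hom G (H Mod N)"
    using Group.hom_compose[OF homh N.r_coset_hom_Mod] by (simp add: comp_def)
  interpret q: group_hom G "H Mod N" "\<lambda>x. N #>\<^bsub>H\<^esub> h x"
    by (rule group_hom.intro[OF G.is_group N.factorgroup_is_group group_hom_axioms.intro[OF hom]])
  have "N #>\<^bsub>H\<^esub> h x = N \<longleftrightarrow> h x \<in> N" if "x \<in> carrier G" for x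
    using H.coset_join1[of N "h x"] H.coset_join2[of "h x" N] N.subgroup_axioms hom_closed[OF that]
    by auto
  then have "kernel G (H Mod N) (\<lambda>x. N #>\<^bsub>H\<^esub> h x) = {x \<in> carrier G. h x \<in> N}"
    by (auto simp: kernel_def FactGroup_def)
  with q.normal_kernel show ?thesis
    by simp
qed

text \<open>The quotient is trivial exactly when every coset \<open>H #> x\<close> equals
  \<open>H\<close>, that is, when every \<open>x\<close> already lies in \<open>H\<close>.\<close>

lemma (in normal) trivial_group_Mod_iff: "trivial_group (G Mod H) \<longleftrightarrow> H = carrier G"
proof -
  interpret q: group "G Mod H"
    by (rule factorgroup_is_group)
  have "trivial_group (G Mod H) \<longleftrightarrow> (\<forall>x\<in>carrier G. H #> x = H)"
    unfolding q.trivial_group_subset by (auto simp: FactGroup_def RCOSETS_def)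
  also have "\<dots> \<longleftrightarrow> H = carrier G"
    using coset_join1[OF _ _ subgroup_axioms] coset_join2[OF _ subgroup_axioms] subset by auto
  finally show ?thesis .
qed

lemma normal_closure_incl: "A \<subseteq> normal_closure G A"
  by (auto simp: normal_closure_def)

lemma normal_closure_minimal: "N \<lhd> G \<Longrightarrow> A \<subseteq> N \<Longrightarrow> normal_closure G A \<subseteq> N"
  by (auto simp: normal_closure_def)

lemma inv_word_inv_word [simp]: "inv_word (inv_word w) = w"
  by (induction w) (auto simp: inv_word_def rev_map)

lemma free_eq_inv_word_right: "w \<in> words n \<Longrightarrow> (w @ inv_word w, []) \<in> free_eq n"
  using free_eq_inv_word[of "inv_word w" n] by simp

lemma subst_word_append: "subst_word S (u @ v) = subst_word S u @ subst_word S v"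
  by (simp add: subst_word_def)

text \<open>Needed for substitution to descend to classes. Only the case \<open>cancel\<close> has
  content: a cancelling pair of letters becomes \<open>S ! j\<close> next to its inverse word, in
  one order or the other, and this product reduces freely to the empty word.\<close>

lemma free_eq_subst_word:
  assumes "(u, v) \<in> free_eq n" "length S = n" "set S \<subseteq> words n"
  shows "(subst_word S u, subst_word S v) \<in> free_eq n"
  using assms(1)
proof (induction rule: free_eq.induct)
  case (refl w)
  then show ?case
    using assms by (intro free_eq.refl subst_word_in_words)
next
  case (sym u v)
  show ?case
    using sym.IH by (rule free_eq.sym)
next
  case (trans u v w)
  show ?case
    using trans.IH by (rule free_eq.trans)
next
  case (cancel u v j e)
  \<comment> \<open>The bound \<open>j < n = length S\<close> makes \<open>S ! j\<close> a genuine
    entry of the tuple.\<close>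
  have "S ! j \<in> words n"
    using cancel assms by (auto simp: subset_iff)
  then have inverse: "(subst_word S [(j, e), (j, \<not> e)], []) \<in> free_eq n"
    by (simp add: subst_word_def free_eq_inv_word free_eq_inv_word_right)
  have "(subst_word S u @ subst_word S [(j, e), (j, \<not> e)] @ subst_word S v,
      subst_word S u @ [] @ subst_word S v) \<in> free_eq n"
    using cancel assms by (intro free_eq_context inverse subst_word_in_words)
  then show ?case
    by (simp only: subst_word_append append_Nil)
qed

text \<open>The endomorphism of the free group that sends the class of \<open>x\<^sub>j\<close> to
  the class of \<open>S ! j\<close>. The union over all representatives avoids choosing one; on a
  class all its members coincide.\<close>

definition free_subst :: "nat \<Rightarrow> word list \<Rightarrow> word set \<Rightarrow> word set" where
  "free_subst n S A = (\<Union>w\<in>A. word_class n (subst_word S w))"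

lemma free_subst_word_class:
  assumes "w \<in> words n" "length S = n" "set S \<subseteq> words n"
  shows "free_subst n S (word_class n w) = word_class n (subst_word S w)"
proof -
  have "word_class n (subst_word S v) = word_class n (subst_word S w)" if "(w, v) \<in> free_eq n" for v
    using free_eq_subst_word[OF that assms(2,3)] free_eq_in_words word_class_eq_iff by metis
  then have "free_subst n S (word_class n w) = (\<Union>v\<in>word_class n w. word_class n (subst_word S w))"
    unfolding free_subst_def by (intro SUP_cong) (auto simp: word_class_def)
  \<comment> \<open>The index set is nonempty, so the union of a constant family collapses to its
    value.\<close>
  moreover have "w \<in> word_class n w"
    using assms by (auto simp: word_class_def intro: free_eq.refl)
  ultimately show ?thesis
    by auto
qed

lemma group_hom_free_subst:
  assumes "length S = n" "set S \<subseteq> words n"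
  shows "group_hom (free_group n) (free_group n) (free_subst n S)"
proof (intro group_hom.intro group_hom_axioms.intro group_free_group homI)
  fix A B assume "A \<in> carrier (free_group n)" "B \<in> carrier (free_group n)"
  then show "free_subst n S (A \<otimes>\<^bsub>free_group n\<^esub> B) =
      free_subst n S A \<otimes>\<^bsub>free_group n\<^esub> free_subst n S B"
    using assms by (auto simp: carrier_free_group mult_free_group free_subst_word_class
        subst_word_append subst_word_in_words)
qed (use assms in \<open>auto simp: carrier_free_group free_subst_word_class subst_word_in_words\<close>)

text \<open>Translates both triviality hypotheses and the goal into statements about normal closures
  inside one free group.\<close>

lemma trivial_presented_group_iff:
  assumes "is_presentation P"
  defines "F \<equiv> free_group (num_gens P)"
  shows "trivial_group (presented_group P) \<longleftrightarrow>
    normal_closure F (word_class (num_gens P) ` set (relators P)) = carrier F"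
  unfolding presented_group_def F_def
  using assms(1)
  by (intro normal.trivial_group_Mod_iff normal_normal_closure group_free_group)
    (auto simp: is_presentation_def carrier_free_group)

theorem lemma4p1:
  fixes P Q :: presentation
  assumes "is_presentation P" and "is_presentation Q"
    and "balanced P" and "balanced Q"
    and "num_gens P = num_gens Q"
    and "trivial_group (presented_group P)"
    and "trivial_group (presented_group Q)"
  shows "trivial_group (presented_group (compose_presentation P Q))"
proof -
  define n where "n = num_gens P"
  define F where "F = free_group n"
  define R where "R = relators P"
  define S where "S = relators Q"
  define RS where "RS = word_class n ` subst_word S ` set R"
  define N where "N = normal_closure F RS"
  \<comment> \<open>The preimage of \<open>N\<close> under the substitution endomorphism.\<close>
  define K where "K = {A \<in> carrier F. free_subst n S A \<in> N}"
  have Q: "num_gens Q = n"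
    using assms(5) by (simp add: n_def)
  have S: "length S = n" "set S \<subseteq> words n" and R: "set R \<subseteq> words n"
    using assms(1,2,4) Q by (auto simp: is_presentation_def balanced_def n_def R_def S_def)
  have clR: "normal_closure F (word_class n ` set R) = carrier F"
    using assms(1,6) by (simp add: trivial_presented_group_iff n_def R_def F_def)
  have clS: "normal_closure F (word_class n ` set S) = carrier F"
    using assms(2,7) Q by (simp add: trivial_presented_group_iff S_def F_def)
  \<comment> \<open>This puts \<open>carrier F\<close> among the normal subgroups intersected in
    \<open>N\<close>, so the family is not empty and \<open>N\<close> is indeed a normal
    subgroup.\<close>
  have "RS \<subseteq> carrier F"
    using R S by (auto simp: RS_def F_def carrier_free_group subst_word_in_words subset_iff)
  then have N: "N \<lhd> F"
    by (simp add: N_def F_def normal_normal_closure group_free_group)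
  interpret group_hom F F "free_subst n S"
    unfolding F_def using S by (rule group_hom_free_subst)
  have "word_class n r \<in> K" if "r \<in> set R" for r
  proof -
    have "word_class n (subst_word S r) \<in> N"
      using that normal_closure_incl[of RS F] by (auto simp: N_def RS_def)
    then show ?thesis
      using that R S by (auto simp: K_def F_def carrier_free_group free_subst_word_class)
  qed
  \<comment> \<open>Reading \<open>carrier F\<close> as the normal closure of the relators of
    \<open>P\<close> reduces the claim to minimality: \<open>K\<close> is normal, being a preimage,
    and contains these relators.\<close>
  then have K: "carrier F \<subseteq> K"
    unfolding clR[symmetric] using normal_preimage[OF N]
    by (intro normal_closure_minimal) (auto simp: K_def)
  have "word_class n s \<in> N" if s: "s \<in> set S" for s
  proof -
    obtain j where j: "j < n" "s = S ! j"
      using s S(1) by (auto simp: in_set_conv_nth)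
    \<comment> \<open>The witness is the generator \<open>x\<^sub>j\<close>: substitution turns this
      one-letter word into \<open>S ! j\<close>, so its membership in \<open>K\<close> says that the
      class of \<open>s\<close> lies in \<open>N\<close>.\<close>
    then have "word_class n [(j, True)] \<in> K"
      using K by (auto simp: F_def carrier_free_group)
    then show ?thesis
      using j S by (simp add: K_def free_subst_word_class subst_word_def)
  qed
  then have "carrier F \<subseteq> N"
    unfolding clS[symmetric] using N by (intro normal_closure_minimal) auto
  then have "N = carrier F"
    using N normal_imp_subgroup subgroup.subset by blast
  moreover have "is_presentation (compose_presentation P Q)"
    using assms by (intro is_presentation_compose)
  ultimately show ?thesis
    by (simp add: trivial_presented_group_iff compose_presentation_def N_def RS_def F_def
        n_def R_def S_def)
qed

end
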